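(* Let $K$ be a field of characteristic zero, let $n=2r+1$ with $r\ge0$ an integer, and let $X_3$ be the $n\times n$ tridiagonal skew-symmetric matrix whose $(i,i+1)$ entry is an indeterminate $x_{i\,i+1}$ and whose $(i+1,i)$ entry is $-x_{i\,i+1}$ for $1\le i\le n-1$, all other entries being $0$. Let $I=\mathrm{Pf}_{n-1}(X_3)\subseteq K[x_{12},x_{23},\dots,x_{n-1\,n}]$. Then the ordinary power $I^s$ and the symbolic power $I^{(s)}$ have linear quotients for all $s\ge1$.
   Context: For a skew-symmetric matrix $M$ of even order, $\mathrm{Pf}(M)$ is the Pfaffian, with $\mathrm{Pf}(M)^2=\det M$ (the Pfaffian of the empty matrix is $1$). $\mathrm{Pf}_{n-1}(X_3)$ is the ideal generated by the Pfaffians of the $n$ submatrices obtained from $X_3$ by deleting the $\ell$-th row and $\ell$-th column, $\ell=1,\dots,n$; it is a squarefree monomial ideal. $I^{(s)}$ denotes the $s$-th symbolic power of $I$ (for a squarefree monomial ideal, $I^{(s)}=\bigcap_{P}P^s$ over the minimal primes $P$ of $I$). A monomial ideal has linear quotients if its minimal monomial generators can be ordered $m_1,\dots,m_q$ so that for every $1\le i\le q-1$ the colon ideal $(\langle m_1,\dots,m_i\rangle:m_{i+1})$ is generated by linear forms. *)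

theory Defs
  imports
    "HOL-Library.Poly_Mapping"
    "HOL-Algebra.Ideal_Product"
    "Jordan_Normal_Form.Determinant"
begin

text \<open>A polynomial is a finitely supported map from exponent vectors to coefficients.
  The number of indeterminates is a natural number depending on the parameters, so the polynomial
  ring in the indeterminates \<open>x\<^sub>v\<close>, \<open>v \<in> V\<close>, is the corresponding subring of the type of all
  polynomials in countably many indeterminates.\<close>

type_synonym 'a mpol = "(nat \<Rightarrow>\<^sub>0 nat) \<Rightarrow>\<^sub>0 'a"

definition pvar :: "nat \<Rightarrow> 'a::comm_ring_1 mpol" where
  "pvar v = Poly_Mapping.single (Poly_Mapping.single v 1) 1"

definition mpol_ring :: "nat set \<Rightarrow> 'a::comm_ring_1 mpol ring" where
  "mpol_ring V =
    \<lparr> carrier = {p. \<forall>m \<in> Poly_Mapping.keys p. Poly_Mapping.keys m \<subseteq> V},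
      monoid.mult = (*), one = 1, zero = 0, add = (+) \<rparr>"

definition monomials :: "nat set \<Rightarrow> 'a::comm_ring_1 mpol set" where
  "monomials V = {Poly_Mapping.single m 1 | m. Poly_Mapping.keys m \<subseteq> V}"

definition linear_forms :: "nat set \<Rightarrow> 'a::comm_ring_1 mpol set" where
  "linear_forms V = {p \<in> carrier (mpol_ring V).
    \<forall>m \<in> Poly_Mapping.keys p. (\<Sum>v\<in>Poly_Mapping.keys m. Poly_Mapping.lookup m v) = 1}"

lemma mpol_ring_cring: "cring (mpol_ring V :: 'a::comm_ring_1 mpol ring)"
proof (rule cringI)
  show "abelian_group (mpol_ring V :: 'a mpol ring)"
  proof (rule abelian_groupI)
    fix p :: "'a mpol" assume p: "p \<in> carrier (mpol_ring V)"
    show "\<exists>q\<in>carrier (mpol_ring V). q \<oplus>\<^bsub>mpol_ring V\<^esub> p = \<zero>\<^bsub>mpol_ring V\<^esub>"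
      using p by (intro bexI[of _ "- p"]) (simp_all add: mpol_ring_def)
  next
    fix p q :: "'a mpol" assume "p \<in> carrier (mpol_ring V)" "q \<in> carrier (mpol_ring V)"
    then show "p \<oplus>\<^bsub>mpol_ring V\<^esub> q \<in> carrier (mpol_ring V)"
      using Poly_Mapping.keys_add[of p q] unfolding mpol_ring_def by (simp, blast)
  qed (simp_all add: mpol_ring_def add.assoc add.commute)
  show "Group.comm_monoid (mpol_ring V :: 'a mpol ring)"
  proof (rule comm_monoidI)
    fix p q :: "'a mpol" assume pq: "p \<in> carrier (mpol_ring V)" "q \<in> carrier (mpol_ring V)"
    have "Poly_Mapping.keys m \<subseteq> V" if m: "m \<in> Poly_Mapping.keys (p * q)" for m
    proof -
      obtain a b where "m = a + b" "a \<in> Poly_Mapping.keys p" "b \<in> Poly_Mapping.keys q"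
        using m Poly_Mapping.keys_mult[of p q] by blast
      then show ?thesis
        using pq Poly_Mapping.keys_add[of a b] unfolding mpol_ring_def by (simp, blast)
    qed
    then show "p \<otimes>\<^bsub>mpol_ring V\<^esub> q \<in> carrier (mpol_ring V)"
      by (simp add: mpol_ring_def)
  qed (simp_all add: mpol_ring_def mult.assoc mult.commute)
qed (simp add: mpol_ring_def distrib_right)

text \<open>The sum over all perfect matchings of the index set; each matching corresponds to exactly
  one permutation \<open>\<sigma>\<close> with \<open>\<sigma>(2i) < \<sigma>(2i+1)\<close> and \<open>\<sigma>(0) < \<sigma>(2) < \<sigma>(4) < \<dots>\<close>.
  Meaningful for skew-symmetric matrices of even order only.\<close>

definition pfaffian :: "'a::comm_ring_1 mat \<Rightarrow> 'a" where
  "pfaffian A = (let m = dim_row A div 2 in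
     \<Sum>\<sigma> | \<sigma> permutes {0..<2 * m} \<and> (\<forall>i<m. \<sigma> (2 * i) < \<sigma> (2 * i + 1))
           \<and> (\<forall>j<m. \<forall>i<j. \<sigma> (2 * i) < \<sigma> (2 * j)).
       of_int (sign \<sigma>) * (\<Prod>i<m. A $$ (\<sigma> (2 * i), \<sigma> (2 * i + 1))))"

lemma pfaffian_empty: "dim_row A = 0 \<Longrightarrow> pfaffian A = 1"
proof -
  assume "dim_row A = 0"
  moreover have "{\<sigma>. \<sigma> = (id :: nat \<Rightarrow> nat)} = {id}" by auto
  ultimately show ?thesis by (simp add: pfaffian_def)
qed

text \<open>Matrix indices start at \<open>0\<close>: the indeterminate \<open>pvar i\<close> in position \<open>(i, i + 1)\<close> is the one
  usually written \<open>x\<close> with subscripts \<open>i + 1, i + 2\<close>. For an \<open>n \<times> n\<close> matrix the indeterminates are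
  thus indexed by \<open>{..<n - 1}\<close>.\<close>

definition X3 :: "nat \<Rightarrow> 'a::comm_ring_1 mpol mat" where
  "X3 n = mat n n (\<lambda>(i, j).
     if j = Suc i then pvar i else if i = Suc j then - pvar j else 0)"

definition Pf_ideal :: "nat \<Rightarrow> 'a::comm_ring_1 mpol set" where
  "Pf_ideal n = Idl\<^bsub>mpol_ring {..<n - 1}\<^esub> {pfaffian (mat_delete (X3 n) l l) | l. l < n}"

definition ideal_power :: "('a, 'b) ring_scheme \<Rightarrow> 'a set \<Rightarrow> nat \<Rightarrow> 'a set" where
  "ideal_power R I s = I [^]\<^bsub>ideals_set R\<^esub> s"

definition minimal_primes :: "('a, 'b) ring_scheme \<Rightarrow> 'a set \<Rightarrow> 'a set set" where
  "minimal_primes R I = {P. primeideal P R \<and> I \<subseteq> P \<and>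
     (\<forall>Q. primeideal Q R \<longrightarrow> I \<subseteq> Q \<longrightarrow> Q \<subseteq> P \<longrightarrow> Q = P)}"

text \<open>This is the symbolic power of a squarefree monomial ideal; for other ideals the powers
  \<open>P\<^sup>s\<close> would have to be replaced by contractions of localisations of \<open>I\<^sup>s\<close>. Intersecting with the
  carrier only matters for the unit ideal, which has no minimal primes.\<close>

definition symbolic_power :: "('a, 'b) ring_scheme \<Rightarrow> 'a set \<Rightarrow> nat \<Rightarrow> 'a set" where
  "symbolic_power R I s = carrier R \<inter> (\<Inter>P\<in>minimal_primes R I. ideal_power R P s)"

definition colon_ideal :: "('a, 'b) ring_scheme \<Rightarrow> 'a set \<Rightarrow> 'a \<Rightarrow> 'a set" where
  "colon_ideal R J m = {f \<in> carrier R. f \<otimes>\<^bsub>R\<^esub> m \<in> J}"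

text \<open>The minimal monomial generators of a monomial ideal are the elements of its unique
  inclusion-minimal generating set consisting of monomials. The list is indexed from \<open>0\<close>, so
  \<open>ms ! i\<close> is the generator following the first \<open>i\<close> ones.\<close>

definition has_linear_quotients :: "nat set \<Rightarrow> 'a::comm_ring_1 mpol set \<Rightarrow> bool" where
  "has_linear_quotients V J \<longleftrightarrow> (\<exists>ms. distinct ms \<and> set ms \<subseteq> monomials V \<and>
     Idl\<^bsub>mpol_ring V\<^esub> (set ms) = J \<and> (\<forall>G. G \<subset> set ms \<longrightarrow> Idl\<^bsub>mpol_ring V\<^esub> G \<noteq> J) \<and>
     (\<forall>i. 1 \<le> i \<and> i < length ms \<longrightarrow>
       (\<exists>L \<subseteq> linear_forms V.
          colon_ideal (mpol_ring V) (Idl\<^bsub>mpol_ring V\<^esub> (set (take i ms))) (ms ! i)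
            = Idl\<^bsub>mpol_ring V\<^esub> L)))"

end

theory Submission
  imports Defs
begin

text \<open>
  Write \<open>a\<^sub>i\<close> for the variable of index \<open>2 * i\<close> and \<open>b\<^sub>i\<close> for that of index \<open>2 * i + 1\<close>, where
  \<open>i < r\<close>. A Pfaffian is a signed sum over perfect matchings, and a nonzero entry of \<open>X3\<close> above the
  diagonal joins two consecutive indices. After deletion of row and column \<open>l\<close> at most one matching
  uses only such entries. It exists for even \<open>l = 2 * k\<close> and gives
  the monomial \<open>a\<^sub>0 \<dots> a\<^sub>k\<^sub>-\<^sub>1 b\<^sub>k \<dots> b\<^sub>r\<^sub>-\<^sub>1\<close>; for odd \<open>l\<close> the Pfaffian is zero (\<open>pfaffian_X3_delete\<close>).

  Multiplying \<open>s\<close> of these monomials, the exponents of \<open>a\<^sub>0, \<dots>, a\<^sub>r\<^sub>-\<^sub>1\<close> form a weakly decreasing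
  sequence \<open>f\<close> with values in \<open>{0..s}\<close>, the exponent of \<open>b\<^sub>j\<close> is \<open>s - f j\<close>, and every such sequence
  occurs (\<open>stair_exp_Suc\<close>). So the \<open>s\<close>-th power is the monomial ideal of these staircases. All
  generators have degree \<open>r * s\<close> and none divides another.

  Linear quotients come from ordering the staircases by the sum of their values. If \<open>h\<close> precedes
  \<open>f\<close>, then \<open>h j < f j\<close> for some \<open>j\<close>, and at the last such \<open>j\<close> the staircase \<open>f\<close> can be lowered by one.
  The lowered staircase comes earlier and shows that \<open>b\<^sub>j\<close> lies in the colon ideal, while \<open>b\<^sub>j\<close>
  divides every monomial that carries the monomial of \<open>f\<close> into the ideal generated by that of \<open>h\<close>
  (\<open>staircase_exchange\<close>). Hence all colon ideals are generated by variables.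

  Finally the symbolic and the ordinary powers coincide. The ideals \<open>(a\<^sub>i, b\<^sub>j)\<close> with \<open>i \<le> j\<close> are
  minimal primes (\<open>minimal_prime_of_Pf_ideal\<close>), so a monomial in the symbolic power has
  \<open>a\<^sub>i\<close>-exponent plus \<open>b\<^sub>j\<close>-exponent at least \<open>s\<close> for all \<open>i \<le> j\<close>; the running minimum of its
  \<open>a\<close>-exponents, cut off at \<open>s\<close>, is a staircase whose monomial divides it (\<open>stair_exp_below\<close>).
\<close>

section \<open>Monomial ideals\<close>

abbreviation monom_of :: "(nat \<Rightarrow>\<^sub>0 nat) \<Rightarrow> 'a::comm_ring_1 mpol" where
  "monom_of e \<equiv> Poly_Mapping.single e 1"

abbreviation unit_exp :: "nat \<Rightarrow> (nat \<Rightarrow>\<^sub>0 nat)" where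
  "unit_exp v \<equiv> Poly_Mapping.single v 1"

text \<open>The type of exponent vectors already carries the lexicographic order \<open>\<le>\<close>, so
  divisibility of monomials needs its own symbol.\<close>

definition divides_exp :: "(nat \<Rightarrow>\<^sub>0 nat) \<Rightarrow> (nat \<Rightarrow>\<^sub>0 nat) \<Rightarrow> bool" (infix \<open>\<preceq>\<close> 50) where
  "u \<preceq> m \<longleftrightarrow> (\<forall>v. Poly_Mapping.lookup u v \<le> Poly_Mapping.lookup m v)"

text \<open>Membership is decided monomial by monomial, so that products, colons and intersections
  of monomial ideals turn into statements about exponent vectors; agreement with generated ideals is
  \<open>genideal_eq_monomial_ideal\<close>.\<close>

definition monomial_ideal ::
    "nat set \<Rightarrow> (nat \<Rightarrow>\<^sub>0 nat) set \<Rightarrow> 'a::comm_ring_1 mpol set" where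
  "monomial_ideal V U =
    {p \<in> carrier (mpol_ring V). \<forall>m\<in>Poly_Mapping.keys p. \<exists>u\<in>U. u \<preceq> m}"

lemma mpol_ring_ring: "ring (mpol_ring V :: 'a::comm_ring_1 mpol ring)"
  using mpol_ring_cring by (rule cring.axioms)

lemma mpol_ring_simps [simp]:
  "p \<otimes>\<^bsub>mpol_ring V\<^esub> q = p * q" "p \<oplus>\<^bsub>mpol_ring V\<^esub> q = p + q"
  "\<one>\<^bsub>mpol_ring V\<^esub> = 1" "\<zero>\<^bsub>mpol_ring V\<^esub> = 0"
  by (simp_all add: mpol_ring_def)

lemma carrier_mpol_ring:
  "p \<in> carrier (mpol_ring V) \<longleftrightarrow> (\<forall>m\<in>Poly_Mapping.keys p. Poly_Mapping.keys m \<subseteq> V)"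
  by (simp add: mpol_ring_def)

lemma monom_of_in_carrier [simp]:
  "(monom_of e :: 'a::comm_ring_1 mpol) \<in> carrier (mpol_ring V) \<longleftrightarrow> Poly_Mapping.keys e \<subseteq> V"
  by (simp add: carrier_mpol_ring)

lemma monom_of_mult: "monom_of u * monom_of w = (monom_of (u + w) :: 'a::comm_ring_1 mpol)"
  by (simp add: mult_single)

lemma monom_of_inject: "(monom_of u :: 'a::comm_ring_1 mpol) = monom_of w \<longleftrightarrow> u = w"
  by (metis keys_single singleton_inject zero_neq_one)

lemma divides_exp_refl [simp]: "u \<preceq> u"
  by (simp add: divides_exp_def)

lemma divides_exp_trans: "u \<preceq> v \<Longrightarrow> v \<preceq> w \<Longrightarrow> u \<preceq> w"
  unfolding divides_exp_def using le_trans by blast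

lemma divides_exp_add_left: "u \<preceq> m \<Longrightarrow> u \<preceq> k + m"
  by (simp add: divides_exp_def lookup_add trans_le_add2)

lemma divides_exp_add_mono: "u \<preceq> m \<Longrightarrow> w \<preceq> k \<Longrightarrow> u + w \<preceq> m + k"
  by (simp add: divides_exp_def lookup_add add_mono)

lemma divides_exp_imp_eq_add: "u \<preceq> m \<Longrightarrow> m = (m - u) + u"
  by (rule poly_mapping_eqI) (simp add: divides_exp_def lookup_add lookup_minus)

lemma keys_exp_add: "Poly_Mapping.keys (u + w :: nat \<Rightarrow>\<^sub>0 nat) = Poly_Mapping.keys u \<union> Poly_Mapping.keys w"
  by (auto simp: in_keys_iff lookup_add)

lemma keys_exp_minus: "Poly_Mapping.keys (u - w :: nat \<Rightarrow>\<^sub>0 nat) \<subseteq> Poly_Mapping.keys u"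
  by (auto simp: in_keys_iff lookup_minus)

lemma unit_exp_divides_iff: "unit_exp v \<preceq> m \<longleftrightarrow> v \<in> Poly_Mapping.keys m"
  by (auto simp: divides_exp_def in_keys_iff lookup_single when_def Suc_le_eq)

lemma monom_of_in_monomial_ideal:
  "(monom_of e :: 'a::comm_ring_1 mpol) \<in> monomial_ideal V U \<longleftrightarrow>
     Poly_Mapping.keys e \<subseteq> V \<and> (\<exists>u\<in>U. u \<preceq> e)"
  by (simp add: monomial_ideal_def)

lemma generator_in_monomial_ideal:
  "u \<in> U \<Longrightarrow> Poly_Mapping.keys u \<subseteq> V \<Longrightarrow> (monom_of u :: 'a::comm_ring_1 mpol) \<in> monomial_ideal V U"
  using divides_exp_refl monom_of_in_monomial_ideal by blast

lemma monomial_ideal_is_ideal: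
  "ideal (monomial_ideal V U :: 'a::comm_ring_1 mpol set) (mpol_ring V)"
proof (rule idealI)
  let ?R = "mpol_ring V :: 'a mpol ring"
  interpret ring ?R by (rule mpol_ring_ring)
  let ?M = "monomial_ideal V U :: 'a mpol set"
  have minus: "\<ominus>\<^bsub>?R\<^esub> p = - p" if "p \<in> carrier ?R" for p
    by (rule minus_equality) (use that in \<open>auto simp: carrier_mpol_ring\<close>)
  show "ring ?R" ..
  show "subgroup ?M (add_monoid ?R)"
  proof (rule add.subgroupI)
    show "?M \<subseteq> carrier ?R" by (auto simp: monomial_ideal_def)
    have "0 \<in> ?M" by (simp add: monomial_ideal_def carrier_mpol_ring)
    then show "?M \<noteq> {}" by blast
  next
    fix p assume "p \<in> ?M"
    then show "\<ominus>\<^bsub>?R\<^esub> p \<in> ?M"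
      using minus by (simp add: monomial_ideal_def carrier_mpol_ring)
  next
    fix p q assume "p \<in> ?M" "q \<in> ?M"
    then show "p \<oplus>\<^bsub>?R\<^esub> q \<in> ?M"
      using Poly_Mapping.keys_add[of p q]
      by (simp add: monomial_ideal_def carrier_mpol_ring) blast
  qed
  have closed: "x * p \<in> ?M" if "p \<in> ?M" "x \<in> carrier ?R" for p x
  proof -
    have "x * p \<in> carrier ?R"
      using that m_closed[of x p] by (simp add: monomial_ideal_def)
    moreover have "\<exists>u\<in>U. u \<preceq> m" if "m \<in> Poly_Mapping.keys (x * p)" for m
    proof -
      obtain k l where "m = k + l" "l \<in> Poly_Mapping.keys p"
        using \<open>m \<in> _\<close> keys_mult[of x p] by blast
      then show ?thesis
        using \<open>p \<in> ?M\<close> divides_exp_add_left unfolding monomial_ideal_def by blast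
    qed
    ultimately show ?thesis by (simp add: monomial_ideal_def)
  qed
  then show "x \<otimes>\<^bsub>?R\<^esub> p \<in> ?M" if "p \<in> ?M" "x \<in> carrier ?R" for p x
    using that by simp
  show "p \<otimes>\<^bsub>?R\<^esub> x \<in> ?M" if "p \<in> ?M" "x \<in> carrier ?R" for p x
    using closed[OF that] by (simp add: mult.commute)
qed

lemma sum_in_ideal:
  assumes "ideal J (mpol_ring V :: 'a::comm_ring_1 mpol ring)" "finite A"
    and "\<And>x. x \<in> A \<Longrightarrow> g x \<in> J"
  shows "sum g A \<in> J"
proof -
  interpret ideal J "mpol_ring V :: 'a mpol ring" by fact
  show ?thesis
    using assms(2,3) additive_subgroup.zero_closed[OF is_additive_subgroup]
      additive_subgroup.a_closed[OF is_additive_subgroup]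
    by (induction A rule: finite_induct) auto
qed

lemma mpol_eq_sum_monomials:
  fixes p :: "'a::comm_ring_1 mpol"
  shows "p = (\<Sum>m\<in>Poly_Mapping.keys p. Poly_Mapping.single m (Poly_Mapping.lookup p m))"
  by (rule poly_mapping_eqI)
     (auto simp: lookup_sum lookup_single when_def sum.delta in_keys_iff cong: if_cong)

text \<open>Every term of a member of the right-hand side is a term multiple of one generator, and
  a polynomial is the sum of its terms.\<close>

lemma genideal_eq_monomial_ideal:
  assumes "\<And>u. u \<in> U \<Longrightarrow> Poly_Mapping.keys u \<subseteq> V"
  shows "Idl\<^bsub>mpol_ring V\<^esub> (monom_of ` U) = (monomial_ideal V U :: 'a::comm_ring_1 mpol set)"
proof
  let ?R = "mpol_ring V :: 'a mpol ring"
  interpret ring ?R by (rule mpol_ring_ring)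
  have gens: "(monom_of ` U :: 'a mpol set) \<subseteq> carrier ?R"
    using assms by auto
  show "Idl\<^bsub>?R\<^esub> (monom_of ` U) \<subseteq> monomial_ideal V U"
    using assms
    by (intro genideal_minimal monomial_ideal_is_ideal)
       (auto intro: generator_in_monomial_ideal)
  let ?J = "Idl\<^bsub>?R\<^esub> (monom_of ` U)"
  interpret J: ideal ?J ?R by (rule genideal_ideal[OF gens])
  show "monomial_ideal V U \<subseteq> ?J"
  proof
    fix p :: "'a mpol" assume p: "p \<in> monomial_ideal V U"
    have "Poly_Mapping.single m (Poly_Mapping.lookup p m) \<in> ?J"
      if m: "m \<in> Poly_Mapping.keys p" for m
    proof -
      obtain u where u: "u \<in> U" "u \<preceq> m"
        using p m by (auto simp: monomial_ideal_def)
      have "Poly_Mapping.single (m - u) (Poly_Mapping.lookup p m) \<in> carrier ?R"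
        using p m keys_exp_minus[of m u]
        by (auto simp: monomial_ideal_def carrier_mpol_ring)
      moreover have "monom_of u \<in> ?J"
        using genideal_self[OF gens] u(1) by blast
      ultimately have "Poly_Mapping.single (m - u) (Poly_Mapping.lookup p m) * monom_of u \<in> ?J"
        using J.I_l_closed by fastforce
      then show ?thesis
        by (simp add: mult_single flip: divides_exp_imp_eq_add[OF u(2)])
    qed
    then have "(\<Sum>m\<in>Poly_Mapping.keys p. Poly_Mapping.single m (Poly_Mapping.lookup p m)) \<in> ?J"
      by (intro sum_in_ideal[OF J.is_ideal]) auto
    then show "p \<in> ?J" by (simp flip: mpol_eq_sum_monomials)
  qed
qed

lemma monomial_ideal_prod:
  assumes "\<And>u. u \<in> U \<Longrightarrow> Poly_Mapping.keys u \<subseteq> V" "\<And>w. w \<in> W \<Longrightarrow> Poly_Mapping.keys w \<subseteq> V"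
  shows "ideal_prod (mpol_ring V) (monomial_ideal V U) (monomial_ideal V W) =
    (monomial_ideal V {u + w | u w. u \<in> U \<and> w \<in> W} :: 'a::comm_ring_1 mpol set)"
    (is "ideal_prod ?R ?I ?J = monomial_ideal V ?UW")
proof
  interpret ring ?R by (rule mpol_ring_ring)
  interpret UW: ideal "monomial_ideal V ?UW" ?R by (rule monomial_ideal_is_ideal)
  show "ideal_prod ?R ?I ?J \<subseteq> monomial_ideal V ?UW"
  proof
    fix x assume "x \<in> ideal_prod ?R ?I ?J"
    then show "x \<in> monomial_ideal V ?UW"
    proof induction
      case (prod p q)
      have "p \<in> carrier ?R" "q \<in> carrier ?R"
        using prod unfolding monomial_ideal_def by blast+
      then have "p * q \<in> carrier ?R"
        using m_closed[of p q] by simp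
      moreover have "\<exists>z\<in>?UW. z \<preceq> m" if m: "m \<in> Poly_Mapping.keys (p * q)" for m
      proof -
        obtain k l where kl: "m = k + l" "k \<in> Poly_Mapping.keys p" "l \<in> Poly_Mapping.keys q"
          using m keys_mult[of p q] by blast
        have "\<exists>u\<in>U. u \<preceq> k" "\<exists>w\<in>W. w \<preceq> l"
          using prod kl(2,3) unfolding monomial_ideal_def by blast+
        then obtain u w where uw: "u \<in> U" "u \<preceq> k" "w \<in> W" "w \<preceq> l" by blast
        then have "u + w \<preceq> m"
          unfolding kl(1) by (intro divides_exp_add_mono)
        moreover have "u + w \<in> ?UW" using uw by blast
        ultimately show ?thesis by (rule bexI)
      qed
      ultimately show ?case
        unfolding monomial_ideal_def mpol_ring_simps by (intro CollectI conjI ballI)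
    next
      case (sum p q)
      show ?case by (rule UW.a_closed[OF sum.IH])
    qed
  qed
  have "Idl\<^bsub>?R\<^esub> (monom_of ` ?UW) \<subseteq> ideal_prod ?R ?I ?J"
  proof (rule genideal_minimal)
    show "ideal (ideal_prod ?R ?I ?J) ?R"
      by (intro ideal_prod_is_ideal monomial_ideal_is_ideal)
    have "monom_of (u + w) \<in> ideal_prod ?R ?I ?J" if "u \<in> U" "w \<in> W" for u w
    proof -
      have "monom_of u \<in> ?I" "monom_of w \<in> ?J"
        using that assms by (auto intro: generator_in_monomial_ideal)
      from ideal_prod.prod[OF this, of ?R] show ?thesis by (simp add: monom_of_mult)
    qed
    then show "monom_of ` ?UW \<subseteq> ideal_prod ?R ?I ?J" by auto
  qed
  moreover have "Idl\<^bsub>?R\<^esub> (monom_of ` ?UW) = monomial_ideal V ?UW"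
    using assms by (intro genideal_eq_monomial_ideal) (fastforce simp: keys_exp_add)
  ultimately show "monomial_ideal V ?UW \<subseteq> ideal_prod ?R ?I ?J" by simp
qed

lemma ideal_power_0: "ideal_power R I 0 = carrier R"
  by (simp add: ideal_power_def nat_pow_def ideals_set_def)

lemma ideal_power_Suc: "ideal_power R I (Suc s) = ideal_prod R (ideal_power R I s) I"
  by (simp add: ideal_power_def nat_pow_def ideals_set_def)

text \<open>The exponent sets \<open>G s\<close> are the \<open>s\<close>-fold sumsets of \<open>W\<close>; they enter through their recursion
  because in the application \<open>G s\<close> has a closed description that is more useful than the sumset.\<close>

lemma monomial_ideal_power:
  assumes G0: "G 0 = {0}"
    and G_Suc: "\<And>s. G (Suc s) = {u + w | u w. u \<in> G s \<and> w \<in> W}"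
    and W: "\<And>w. w \<in> W \<Longrightarrow> Poly_Mapping.keys w \<subseteq> V"
  shows "ideal_power (mpol_ring V) (monomial_ideal V W) s =
    (monomial_ideal V (G s) :: 'a::comm_ring_1 mpol set)"
proof (induction s)
  case 0
  show ?case by (auto simp: ideal_power_0 monomial_ideal_def G0 divides_exp_def)
next
  case (Suc s)
  have "Poly_Mapping.keys u \<subseteq> V" if "u \<in> G t" for u t
    using that by (induction t arbitrary: u) (use W in \<open>fastforce simp: G0 G_Suc keys_exp_add\<close>)+
  then show ?case
    using W by (simp add: ideal_power_Suc Suc.IH monomial_ideal_prod G_Suc)
qed

lemma ideal_prod_mono:
  assumes "I \<subseteq> I'" "J \<subseteq> J'"
  shows "ideal_prod R I J \<subseteq> ideal_prod R I' J'"
proof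
  fix x assume "x \<in> ideal_prod R I J"
  then show "x \<in> ideal_prod R I' J'"
    by induction (use assms in \<open>auto intro: ideal_prod.intros\<close>)
qed

lemma ideal_power_mono: "I \<subseteq> J \<Longrightarrow> ideal_power R I s \<subseteq> ideal_power R J s"
  by (induction s) (simp_all add: ideal_power_0 ideal_power_Suc ideal_prod_mono)

section \<open>Prime ideals generated by variables\<close>

lemma mpol_split:
  fixes p :: "'a::comm_ring_1 mpol"
  obtains p0 p1 where "p = p0 + p1" "Poly_Mapping.keys p0 = {m \<in> Poly_Mapping.keys p. Q m}"
    "Poly_Mapping.keys p1 = {m \<in> Poly_Mapping.keys p. \<not> Q m}"
proof
  let ?part = "\<lambda>Q. Poly_Mapping.mapp (\<lambda>m c. c when Q m) p"
  show "p = ?part Q + ?part (\<lambda>m. \<not> Q m)"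
    by (rule poly_mapping_eqI) (auto simp: lookup_add lookup_mapp when_def in_keys_iff)
qed (auto simp: in_keys_iff lookup_mapp when_def split: if_splits)

text \<open>Modulo the ideal only the terms free of the variables in \<open>W\<close> survive. If \<open>p * q\<close> lies in
  the ideal, then the product of the surviving parts of \<open>p\<close> and \<open>q\<close> has only terms that meet \<open>W\<close>
  and, being built from terms avoiding \<open>W\<close>, only terms that avoid it. So that product vanishes, and
  polynomials over a domain have no zero divisors.\<close>

lemma primeideal_variables:
  "primeideal (monomial_ideal V (unit_exp ` W) :: 'a::idom mpol set) (mpol_ring V)"
proof (rule primeidealI)
  let ?R = "mpol_ring V :: 'a mpol ring"
  let ?P = "monomial_ideal V (unit_exp ` W) :: 'a mpol set"
  let ?Q = "\<lambda>m::nat \<Rightarrow>\<^sub>0 nat. Poly_Mapping.keys m \<inter> W = {}"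
  have P_iff: "p \<in> ?P \<longleftrightarrow> p \<in> carrier ?R \<and> (\<forall>m\<in>Poly_Mapping.keys p. \<not> ?Q m)" for p
    by (auto simp: monomial_ideal_def unit_exp_divides_iff simp del: One_nat_def)
  show "ideal ?P ?R" by (rule monomial_ideal_is_ideal)
  show "cring ?R" by (rule mpol_ring_cring)
  show "carrier ?R \<noteq> ?P"
  proof -
    have "1 \<in> carrier ?R" "1 \<notin> ?P" by (simp_all only: P_iff) (auto simp: carrier_mpol_ring)
    then show ?thesis by blast
  qed
  fix p q assume p: "p \<in> carrier ?R" and q: "q \<in> carrier ?R" and pq: "p \<otimes>\<^bsub>?R\<^esub> q \<in> ?P"
  obtain p0 p1 where p01: "p = p0 + p1" "Poly_Mapping.keys p0 = {m \<in> Poly_Mapping.keys p. ?Q m}"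
    "Poly_Mapping.keys p1 = {m \<in> Poly_Mapping.keys p. \<not> ?Q m}" by (rule mpol_split)
  obtain q0 q1 where q01: "q = q0 + q1" "Poly_Mapping.keys q0 = {m \<in> Poly_Mapping.keys q. ?Q m}"
    "Poly_Mapping.keys q1 = {m \<in> Poly_Mapping.keys q. \<not> ?Q m}" by (rule mpol_split)
  have eq: "p0 * q0 = p * q - (p0 * q1 + p1 * q)"
    by (simp add: p01(1) q01(1) algebra_simps)
  have "?Q m" if "m \<in> Poly_Mapping.keys (p0 * q0)" for m
    using that keys_mult[of p0 q0] p01(2) q01(2) by (fastforce simp: keys_exp_add)
  moreover have "\<not> ?Q m" if "m \<in> Poly_Mapping.keys (p0 * q0)" for m
  proof -
    have "m \<in> Poly_Mapping.keys (p * q) \<union> Poly_Mapping.keys (p0 * q1) \<union> Poly_Mapping.keys (p1 * q)"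
      using that unfolding eq by (auto simp: in_keys_iff lookup_minus lookup_add)
    moreover have "\<not> ?Q m" if "m \<in> Poly_Mapping.keys (p0 * q1)"
      using that keys_mult[of p0 q1] q01(3) by (fastforce simp: keys_exp_add)
    moreover have "\<not> ?Q m" if "m \<in> Poly_Mapping.keys (p1 * q)"
      using that keys_mult[of p1 q] p01(3) by (fastforce simp: keys_exp_add)
    moreover have "\<not> ?Q m" if "m \<in> Poly_Mapping.keys (p * q)"
      using that pq P_iff by simp
    ultimately show ?thesis by blast
  qed
  ultimately have "Poly_Mapping.keys (p0 * q0) = {}" by blast
  then have "p0 * q0 = 0" by simp
  then have "p0 = 0 \<or> q0 = 0" by simp
  then show "p \<in> ?P \<or> q \<in> ?P"
    unfolding P_iff using p q p01(2) q01(2) by auto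
qed

text \<open>Each factor from the prime contributes at least one variable of \<open>W\<close>, so the terms of the
  \<open>s\<close>-th power have degree at least \<open>s\<close> in these variables. This is the half of the description of
  the power that bounds symbolic powers from above.\<close>

lemma lookup_prime_power:
  assumes "finite W" "p \<in> ideal_power (mpol_ring V) (monomial_ideal V (unit_exp ` W)) s"
    and "m \<in> Poly_Mapping.keys (p :: 'a::comm_ring_1 mpol)"
  shows "s \<le> (\<Sum>v\<in>W. Poly_Mapping.lookup m v)"
  using assms(2,3)
proof (induction s arbitrary: p m)
  case (Suc s)
  let ?P = "monomial_ideal V (unit_exp ` W) :: 'a mpol set"
  from Suc.prems show ?case unfolding ideal_power_Suc
  proof (induction arbitrary: m)
    case (prod p q)
    obtain k l where kl: "m = k + l" "k \<in> Poly_Mapping.keys p" "l \<in> Poly_Mapping.keys q"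
      using prod.prems keys_mult[of p q] by auto
    obtain w where "w \<in> W" "w \<in> Poly_Mapping.keys l"
      using prod.hyps(2) kl(3) unfolding monomial_ideal_def
      by (auto simp: unit_exp_divides_iff simp del: One_nat_def)
    then have "1 \<le> (\<Sum>v\<in>W. Poly_Mapping.lookup l v)"
      using member_le_sum[of w W "Poly_Mapping.lookup l"] \<open>finite W\<close>
      by (simp add: in_keys_iff)
    moreover have "s \<le> (\<Sum>v\<in>W. Poly_Mapping.lookup k v)"
      by (rule Suc.IH[OF prod.hyps(1) kl(2)])
    ultimately show ?case
      by (simp add: kl(1) lookup_add sum.distrib)
  next
    case (sum p q)
    then show ?case using Poly_Mapping.keys_add[of p q] by auto
  qed
qed simp

lemma primeideal_prod_mem:
  assumes Q: "primeideal Q (mpol_ring V :: 'a::comm_ring_1 mpol ring)"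
    and "finite A" "\<And>x. x \<in> A \<Longrightarrow> f x \<in> carrier (mpol_ring V)" "prod f A \<in> Q"
  shows "\<exists>x\<in>A. f x \<in> Q"
proof -
  interpret primeideal Q "mpol_ring V :: 'a mpol ring" by (rule Q)
  have "1 \<notin> Q"
    using one_imp_carrier I_notcarr by auto
  from assms(2,3)
  have "prod f A \<in> carrier (mpol_ring V) \<and> (prod f A \<in> Q \<longrightarrow> (\<exists>x\<in>A. f x \<in> Q))"
  proof (induction A rule: finite_induct)
    case (insert x A)
    then have "f x \<in> carrier (mpol_ring V)" "prod f A \<in> carrier (mpol_ring V)"
      by auto
    then show ?case
      using insert I_prime[of "f x" "prod f A"] m_closed[of "f x" "prod f A"] by auto
  qed (use one_closed \<open>1 \<notin> Q\<close> in auto)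
  then show ?thesis using assms(4) by blast
qed

section \<open>Colon ideals and linear quotients\<close>

lemma keys_mult_monom_of:
  fixes p :: "'a::comm_ring_1 mpol"
  shows "Poly_Mapping.keys (p * monom_of e) = (\<lambda>k. k + e) ` Poly_Mapping.keys p"
proof
  show "Poly_Mapping.keys (p * monom_of e) \<subseteq> (\<lambda>k. k + e) ` Poly_Mapping.keys p"
    using keys_mult[of p "monom_of e"] by auto
  have "p * monom_of e = (\<Sum>k\<in>Poly_Mapping.keys p. Poly_Mapping.single (k + e) (Poly_Mapping.lookup p k))"
    by (subst mpol_eq_sum_monomials[of p]) (simp add: sum_distrib_right mult_single)
  then have "Poly_Mapping.lookup (p * monom_of e) (k + e) = Poly_Mapping.lookup p k"
    if "k \<in> Poly_Mapping.keys p" for k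
    using that by (simp add: lookup_sum lookup_single when_def)
  then show "(\<lambda>k. k + e) ` Poly_Mapping.keys p \<subseteq> Poly_Mapping.keys (p * monom_of e)"
    by (auto simp: in_keys_iff)
qed

text \<open>The hypothesis says that each generator \<open>u\<close> needs some variable \<open>v\<close> to a higher power than
  \<open>e\<close> provides, where \<open>v\<close> alone already carries \<open>e\<close> into the ideal. Whenever a monomial \<open>k\<close> multiplies
  \<open>e\<close> into the ideal by way of \<open>u\<close>, this \<open>v\<close> divides \<open>k\<close>; hence such variables generate the colon.\<close>

lemma colon_monomial_ideal:
  assumes e: "Poly_Mapping.keys e \<subseteq> V"
    and dom: "\<And>u. u \<in> U \<Longrightarrow> \<exists>v\<in>V. Poly_Mapping.lookup e v < Poly_Mapping.lookup u v \<and>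
                 (\<exists>u'\<in>U. u' \<preceq> e + unit_exp v)"
  shows "colon_ideal (mpol_ring V) (monomial_ideal V U) (monom_of e) =
    (monomial_ideal V (unit_exp ` {v \<in> V. \<exists>u\<in>U. u \<preceq> e + unit_exp v}) :: 'a::comm_ring_1 mpol set)"
    (is "?C = monomial_ideal V (unit_exp ` ?D)")
proof -
  let ?R = "mpol_ring V :: 'a mpol ring"
  interpret ring ?R by (rule mpol_ring_ring)
  have "(\<exists>u\<in>U. u \<preceq> k + e) \<longleftrightarrow> (\<exists>v\<in>?D. unit_exp v \<preceq> k)" for k
  proof
    assume "\<exists>u\<in>U. u \<preceq> k + e"
    then obtain u where u: "u \<in> U" "u \<preceq> k + e" by blast
    obtain v where v: "v \<in> V" "Poly_Mapping.lookup e v < Poly_Mapping.lookup u v"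
      "\<exists>u'\<in>U. u' \<preceq> e + unit_exp v"
      using dom[OF u(1)] by blast
    have "Poly_Mapping.lookup u v \<le> Poly_Mapping.lookup k v + Poly_Mapping.lookup e v"
      using u(2) by (simp add: divides_exp_def lookup_add)
    then have "v \<in> Poly_Mapping.keys k"
      using v(2) by (simp add: in_keys_iff)
    then show "\<exists>v\<in>?D. unit_exp v \<preceq> k"
      using v unit_exp_divides_iff by blast
  next
    assume "\<exists>v\<in>?D. unit_exp v \<preceq> k"
    then obtain v u where "u \<in> U" "u \<preceq> e + unit_exp v" "unit_exp v \<preceq> k" by blast
    then show "\<exists>u\<in>U. u \<preceq> k + e"
      by (metis add.commute divides_exp_add_mono divides_exp_refl divides_exp_trans)
  qed
  moreover have "p * monom_of e \<in> carrier ?R" if "p \<in> carrier ?R" for p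
    using that e m_closed[of p "monom_of e"] by simp
  ultimately show ?thesis
    by (auto simp: colon_ideal_def monomial_ideal_def keys_mult_monom_of simp del: One_nat_def)
qed

text \<open>A combinatorial criterion. Pairwise indivisibility makes the generators minimal. The
  exchange condition lets any obstruction coming from an earlier generator \<open>es ! k\<close> be replaced by a
  single variable, so that all colon ideals are generated by variables.\<close>

lemma has_linear_quotients_monomial_ideal:
  assumes "distinct es" and V: "\<And>e. e \<in> set es \<Longrightarrow> Poly_Mapping.keys e \<subseteq> V"
    and antichain: "\<And>u w. u \<in> set es \<Longrightarrow> w \<in> set es \<Longrightarrow> u \<preceq> w \<Longrightarrow> u = w"
    and exchange: "\<And>i k. k < i \<Longrightarrow> i < length es \<Longrightarrow>
      \<exists>v\<in>V. Poly_Mapping.lookup (es ! i) v < Poly_Mapping.lookup (es ! k) v \<and>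
         (\<exists>l<i. es ! l \<preceq> es ! i + unit_exp v)"
  shows "has_linear_quotients V (monomial_ideal V (set es) :: 'a::comm_ring_1 mpol set)"
  unfolding has_linear_quotients_def
proof (intro exI[of _ "map monom_of es"] conjI allI impI)
  let ?R = "mpol_ring V :: 'a mpol ring"
  let ?ms = "map monom_of es :: 'a mpol list"
  show "distinct ?ms"
    using \<open>distinct es\<close> by (simp add: distinct_map inj_on_def monom_of_inject)
  show "set ?ms \<subseteq> monomials V"
    using V by (auto simp: monomials_def)
  have genideal: "Idl\<^bsub>?R\<^esub> (monom_of ` U) = monomial_ideal V U" if "U \<subseteq> set es" for U
    using that V by (intro genideal_eq_monomial_ideal) auto
  then show "Idl\<^bsub>?R\<^esub> (set ?ms) = monomial_ideal V (set es)"
    by simp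
  show "Idl\<^bsub>?R\<^esub> G \<noteq> monomial_ideal V (set es)" if G: "G \<subset> set ?ms" for G
  proof
    assume eq: "Idl\<^bsub>?R\<^esub> G = monomial_ideal V (set es)"
    obtain U where U: "U \<subseteq> set es" "G = monom_of ` U"
      using G by (metis psubset_imp_subset set_map subset_image_iff)
    with G obtain u where u: "u \<in> set es" "u \<notin> U" by auto
    have "(monom_of u :: 'a mpol) \<in> monomial_ideal V (set es)"
      using u V by (intro generator_in_monomial_ideal) auto
    then have "(monom_of u :: 'a mpol) \<in> monomial_ideal V U"
      using eq U genideal by simp
    then obtain w where "w \<in> U" "w \<preceq> u"
      by (auto simp: monom_of_in_monomial_ideal)
    then show False using antichain U u by blast
  qed
  fix i assume "1 \<le> i \<and> i < length ?ms"
  then have i: "i < length es" by simp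
  let ?U = "set (take i es)"
  let ?L = "monom_of ` unit_exp ` {v \<in> V. \<exists>u\<in>?U. u \<preceq> es ! i + unit_exp v} :: 'a mpol set"
  have take: "set (take i ?ms) = monom_of ` ?U"
    by (simp add: take_map)
  have U: "?U = (\<lambda>k. es ! k) ` {..<i}"
    using i by (simp add: lessThan_atLeast0 nth_image)
  have "?L \<subseteq> linear_forms V"
    by (auto simp: linear_forms_def)
  moreover have "colon_ideal ?R (monomial_ideal V ?U) (monom_of (es ! i)) = Idl\<^bsub>?R\<^esub> ?L"
  proof (subst colon_monomial_ideal)
    show "Poly_Mapping.keys (es ! i) \<subseteq> V"
      using i V by simp
    show "\<exists>v\<in>V. Poly_Mapping.lookup (es ! i) v < Poly_Mapping.lookup u v \<and>
        (\<exists>u'\<in>?U. u' \<preceq> es ! i + unit_exp v)" if "u \<in> ?U" for u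
    proof -
      from that obtain k where "k < i" "u = es ! k" unfolding U by blast
      with exchange[of k i] i show ?thesis unfolding U by blast
    qed
    show "monomial_ideal V (unit_exp ` {v \<in> V. \<exists>u\<in>?U. u \<preceq> es ! i + unit_exp v}) = Idl\<^bsub>?R\<^esub> ?L"
      by (rule genideal_eq_monomial_ideal[symmetric]) auto
  qed
  moreover have "Idl\<^bsub>?R\<^esub> (monom_of ` ?U) = monomial_ideal V ?U"
    by (rule genideal) (rule set_take_subset)
  ultimately show "\<exists>L\<subseteq>linear_forms V.
      colon_ideal ?R (Idl\<^bsub>?R\<^esub> (set (take i ?ms))) (?ms ! i) = Idl\<^bsub>?R\<^esub> L"
    using i take by (intro exI[of _ ?L]) simp
qed

section \<open>Staircases\<close>

text \<open>The value \<open>0\<close> at \<open>r\<close> propagates to all later places. Only the values below \<open>r\<close> become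
  exponents, and with the others fixed a staircase can be recovered from its monomial.\<close>

definition staircases :: "nat \<Rightarrow> nat \<Rightarrow> (nat \<Rightarrow> nat) set" where
  "staircases r s = {f. antimono f \<and> f 0 \<le> s \<and> f r = 0}"

text \<open>With \<open>a\<^sub>j\<close> for the variable of index \<open>2 * j\<close> and \<open>b\<^sub>j\<close> for that of index \<open>2 * j + 1\<close>, this is
  the exponent of the product of all \<open>a\<^sub>j\<close> to the power \<open>f j\<close> and all \<open>b\<^sub>j\<close> to the power
  \<open>s - f j\<close>, where \<open>j < r\<close>.\<close>

definition stair_exp :: "nat \<Rightarrow> nat \<Rightarrow> (nat \<Rightarrow> nat) \<Rightarrow> (nat \<Rightarrow>\<^sub>0 nat)" where
  "stair_exp r s f = Poly_Mapping.Abs_poly_mapping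
    (\<lambda>v. if v < 2 * r then if even v then f (v div 2) else s - f (v div 2) else 0)"

lemma lookup_stair_exp:
  "Poly_Mapping.lookup (stair_exp r s f) v =
    (if v < 2 * r then if even v then f (v div 2) else s - f (v div 2) else 0)"
proof -
  have "finite {v. (if v < 2 * r then if even v then f (v div 2) else s - f (v div 2) else 0) \<noteq> 0}"
    by (rule finite_subset[of _ "{..<2 * r}"]) (auto split: if_splits)
  then show ?thesis unfolding stair_exp_def by (subst lookup_Abs_poly_mapping) auto
qed

lemma keys_stair_exp: "Poly_Mapping.keys (stair_exp r s f) \<subseteq> {..<2 * r}"
  by (auto simp: in_keys_iff lookup_stair_exp split: if_splits)

lemma staircase_antimono: "f \<in> staircases r s \<Longrightarrow> j \<le> k \<Longrightarrow> f k \<le> f j"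
  by (simp add: staircases_def antimonoD)

lemma staircase_le: "f \<in> staircases r s \<Longrightarrow> f j \<le> s"
  using staircase_antimono[of f r s 0 j] by (simp add: staircases_def)

lemma staircase_eq_0: "f \<in> staircases r s \<Longrightarrow> r \<le> j \<Longrightarrow> f j = 0"
  using staircase_antimono[of f r s r j] by (simp add: staircases_def)

lemma finite_staircases: "finite (staircases r s)"
proof (rule finite_subset)
  show "staircases r s \<subseteq> {f. \<forall>j. (j \<in> {..<r} \<longrightarrow> f j \<in> {..s}) \<and> (j \<notin> {..<r} \<longrightarrow> f j = 0)}"
    by (auto intro: staircase_le staircase_eq_0)
  show "finite {f. \<forall>j. (j \<in> {..<r} \<longrightarrow> f j \<in> {..s}) \<and> (j \<notin> {..<r} \<longrightarrow> f j = (0::nat))}"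
    by (rule finite_set_of_finite_funs) auto
qed

lemma stair_exp_antichain:
  assumes f: "f \<in> staircases r s" and g: "g \<in> staircases r s"
    and le: "stair_exp r s f \<preceq> stair_exp r s g"
  shows "f = g"
proof
  fix j
  show "f j = g j"
  proof (cases "j < r")
    case True
    then have "f j \<le> g j" "s - f j \<le> s - g j"
      using le[unfolded divides_exp_def lookup_stair_exp, rule_format, of "2 * j"]
        le[unfolded divides_exp_def lookup_stair_exp, rule_format, of "2 * j + 1"] by auto
    then show ?thesis
      using staircase_le[OF f, of j] staircase_le[OF g, of j] by linarith
  next
    case False
    then show ?thesis using staircase_eq_0[OF f, of j] staircase_eq_0[OF g, of j] by simp
  qed
qed

lemma staircases_0: "staircases r 0 = {\<lambda>_. 0}"
proof
  show "staircases r 0 \<subseteq> {\<lambda>_. 0}" using staircase_le[of _ r 0] by fastforce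
qed (simp add: staircases_def antimono_def)

lemma stair_exp_0: "stair_exp r 0 ` staircases r 0 = {0}"
proof -
  have "stair_exp r 0 (\<lambda>_. 0) = 0"
    by (rule poly_mapping_eqI) (simp add: lookup_stair_exp)
  then show ?thesis by (simp add: staircases_0)
qed

lemma stair_exp_add:
  assumes "g \<in> staircases r s" "h \<in> staircases r t"
  shows "stair_exp r s g + stair_exp r t h = stair_exp r (s + t) (\<lambda>j. g j + h j)"
  using staircase_le[OF assms(1)] staircase_le[OF assms(2)]
  by (intro poly_mapping_eqI) (auto simp: lookup_add lookup_stair_exp)

text \<open>A staircase of height \<open>s + 1\<close> splits into its truncation at height \<open>s\<close> and what sticks out
  above, which is the indicator function of an initial segment and so a staircase of height one.\<close>

lemma stair_exp_Suc:
  "stair_exp r (Suc s) ` staircases r (Suc s) =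
    {u + w | u w. u \<in> stair_exp r s ` staircases r s \<and> w \<in> stair_exp r 1 ` staircases r 1}"
    (is "?L = ?R")
proof
  show "?R \<subseteq> ?L"
  proof
    fix e assume "e \<in> ?R"
    then obtain g h where gh: "e = stair_exp r s g + stair_exp r 1 h"
      "g \<in> staircases r s" "h \<in> staircases r 1" by blast
    then have "(\<lambda>j. g j + h j) \<in> staircases r (Suc s)"
      using add_mono[of "g 0" s "h 0" 1]
      by (auto simp: staircases_def antimono_def intro!: add_mono)
    then show "e \<in> ?L"
      using gh stair_exp_add[of g r s h 1] by simp
  qed
  show "?L \<subseteq> ?R"
  proof
    fix e assume "e \<in> ?L"
    then obtain f where f: "e = stair_exp r (Suc s) f" "f \<in> staircases r (Suc s)" by blast
    \<comment> \<open>truncation at height \<open>s\<close>, and the remainder with values in \<open>{0, 1}\<close>\<close>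
    let ?g = "\<lambda>j. min s (f j)" and ?h = "\<lambda>j. f j - min s (f j)"
    have anti: "f k \<le> f j" if "j \<le> k" for j k
      using staircase_antimono[OF f(2) that] .
    have "?g \<in> staircases r s"
      using f(2) anti by (auto simp: staircases_def antimono_def min_le_iff_disj)
    moreover have "?h \<in> staircases r 1"
    proof -
      have "?h y \<le> ?h x" if "x \<le> y" for x y
        using anti[OF that] by linarith
      then show ?thesis
        using f(2) by (auto simp: staircases_def antimono_def)
    qed
    moreover from calculation have "e = stair_exp r s ?g + stair_exp r 1 ?h"
      using f(1) by (simp add: stair_exp_add)
    ultimately show "e \<in> ?R" by blast
  qed
qed

text \<open>The condition for all \<open>i \<le> j\<close> says that \<open>m\<close> has degree at least \<open>s\<close> in each pair
  \<open>a\<^sub>i, b\<^sub>j\<close>. The largest staircase below the \<open>a\<close>-exponents of \<open>m\<close> is their running minimum, cut off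
  at \<open>s\<close>; where it falls short of \<open>s\<close>, it equals some \<open>a\<^sub>i\<close>-exponent with \<open>i \<le> j\<close>, and the condition
  for that pair supplies the complementary power of \<open>b\<^sub>j\<close>.\<close>

lemma stair_exp_below:
  assumes edge: "\<And>i j. i \<le> j \<Longrightarrow> j < r \<Longrightarrow>
    s \<le> Poly_Mapping.lookup m (2 * i) + Poly_Mapping.lookup m (2 * j + 1)"
  shows "\<exists>f\<in>staircases r s. stair_exp r s f \<preceq> m"
proof -
  define M where "M j = Min (insert s ((\<lambda>i. Poly_Mapping.lookup m (2 * i)) ` {..j}))" for j
  define f where "f j = (if j < r then M j else 0)" for j
  have "M k \<le> M j" if "j \<le> k" for j k
    unfolding M_def using that by (intro Min_antimono) auto
  then have "f \<in> staircases r s"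
    by (auto simp: staircases_def antimono_def f_def M_def)
  moreover have "stair_exp r s f \<preceq> m"
    unfolding divides_exp_def
  proof
    fix v :: nat
    let ?j = "v div 2"
    have "M ?j \<le> Poly_Mapping.lookup m (2 * ?j)"
      unfolding M_def by (intro Min_le) auto
    moreover have "s - M ?j \<le> Poly_Mapping.lookup m (2 * ?j + 1)" if "?j < r"
    proof -
      have "M ?j \<in> insert s ((\<lambda>i. Poly_Mapping.lookup m (2 * i)) ` {..?j})"
        unfolding M_def by (intro Min_in) auto
      then show ?thesis
        using edge[OF _ that] by fastforce
    qed
    moreover have "v < 2 * r \<longleftrightarrow> ?j < r" by auto
    ultimately show "Poly_Mapping.lookup (stair_exp r s f) v \<le> Poly_Mapping.lookup m v"
      by (cases "even v") (auto simp: lookup_stair_exp f_def elim!: oddE)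
  qed
  ultimately show ?thesis by blast
qed

text \<open>Lowering \<open>f\<close> by one at \<open>j\<close> trades a factor \<open>a\<^sub>j\<close> for \<open>b\<^sub>j\<close>, so the lowered monomial divides
  \<open>b\<^sub>j\<close> times the old one. The place \<open>j\<close> has to be chosen so that the lowered function is still a
  staircase: at the last \<open>j\<close> with \<open>h j < f j\<close> the value of \<open>f\<close> must drop strictly, because later on
  \<open>f\<close> is bounded by \<open>h\<close>, which is at most \<open>h j\<close>.\<close>

lemma staircase_exchange:
  assumes h: "h \<in> staircases r s" and f: "f \<in> staircases r s"
    and ne: "h \<noteq> f" and weight: "sum h {..<r} \<le> sum f {..<r}"
  obtains j g where "j < r" "h j < f j" "g \<in> staircases r s" "sum g {..<r} < sum f {..<r}"
    "stair_exp r s g \<preceq> stair_exp r s f + unit_exp (2 * j + 1)"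
proof -
  let ?J = "{j. j < r \<and> h j < f j}"
  have "?J \<noteq> {}"
  proof
    assume "?J = {}"
    then have le: "f j \<le> h j" if "j < r" for j using that leI by blast
    obtain i where i: "h i \<noteq> f i" using ne by blast
    then have "i < r" using staircase_eq_0 h f by (metis not_less)
    then have "f i < h i" using le i by (simp add: le_neq_implies_less)
    then have "sum f {..<r} < sum h {..<r}"
      using le \<open>i < r\<close> by (intro sum_strict_mono_ex1) auto
    then show False using weight by simp
  qed
  \<comment> \<open>the last place, so that beyond it \<open>f\<close> stays below \<open>h\<close>\<close>
  define j where "j = Max ?J"
  have fin: "finite ?J" by simp
  have j: "j < r" "h j < f j"
    using Max_in[OF fin \<open>?J \<noteq> {}\<close>] by (auto simp: j_def)
  have above: "f k \<le> h k" if "j < k" for k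
  proof (cases "k < r")
    case True
    then show ?thesis
      using that Max_ge[OF fin, of k] by (fastforce simp: j_def not_less[symmetric])
  qed (use staircase_eq_0[OF f] in simp)
  define g where "g = f(j := f j - 1)"
  have anti: "f l \<le> f k" "h l \<le> h k" if "k \<le> l" for k l
    using that staircase_antimono f h by blast+
  have drop: "f k \<le> f j - 1" if "j < k" for k
    using above[OF that] anti(2)[of j k] that j(2) by linarith
  have "g l \<le> g k" if "k \<le> l" for k l
    using anti(1)[OF that] drop[of l] that by (auto simp: g_def)
  then have g: "g \<in> staircases r s"
    using f by (auto simp: staircases_def antimono_def g_def)
  moreover have "sum g {..<r} < sum f {..<r}"
    using j by (intro sum_strict_mono_ex1) (auto simp: g_def intro!: bexI[of _ j])
  moreover have "stair_exp r s g \<preceq> stair_exp r s f + unit_exp (2 * j + 1)"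
    using j(1) staircase_le[OF f, of j]
    by (auto simp: divides_exp_def lookup_stair_exp lookup_add lookup_single when_def g_def
             elim!: oddE)
  ultimately show ?thesis using j that by blast
qed

text \<open>Any order of the generators with weakly increasing \<open>sum f {..<r}\<close> works, since the exchange
  always leads to a staircase of smaller weight.\<close>

lemma has_linear_quotients_staircases:
  "has_linear_quotients {..<2 * r}
    (monomial_ideal {..<2 * r} (stair_exp r s ` staircases r s) :: 'a::comm_ring_1 mpol set)"
proof -
  obtain fs0 where fs0: "set fs0 = staircases r s" "distinct fs0"
    using finite_distinct_list[OF finite_staircases] by blast
  define fs where "fs = sort_key (\<lambda>f. sum f {..<r}) fs0"
  have fs: "set fs = staircases r s" "distinct fs" "sorted (map (\<lambda>f. sum f {..<r}) fs)"
    using fs0 by (simp_all add: fs_def)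
  have mono: "sum (fs ! k) {..<r} \<le> sum (fs ! i) {..<r}" if "k \<le> i" "i < length fs" for k i
    using sorted_nth_mono[OF fs(3) that(1)] that by simp
  let ?es = "map (stair_exp r s) fs"
  have "has_linear_quotients {..<2 * r} (monomial_ideal {..<2 * r} (set ?es) :: 'a mpol set)"
  proof (rule has_linear_quotients_monomial_ideal)
    have "inj_on (stair_exp r s) (staircases r s)"
      by (intro inj_onI stair_exp_antichain) auto
    then show "distinct ?es" using fs by (simp add: distinct_map)
    show "Poly_Mapping.keys e \<subseteq> {..<2 * r}" if "e \<in> set ?es" for e
      using that keys_stair_exp by auto
    show "u = w" if "u \<in> set ?es" "w \<in> set ?es" "u \<preceq> w" for u w
      using that stair_exp_antichain fs(1) by auto
    fix i k assume ki: "k < i" "i < length ?es"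
    then have mem: "fs ! k \<in> staircases r s" "fs ! i \<in> staircases r s"
      using fs(1) nth_mem[of k fs] nth_mem[of i fs] by auto
    have "fs ! k \<noteq> fs ! i" "sum (fs ! k) {..<r} \<le> sum (fs ! i) {..<r}"
      using ki fs(2) mono by (auto simp: nth_eq_iff_index_eq)
    then obtain j g where j: "j < r" "(fs ! k) j < (fs ! i) j"
      and g: "g \<in> staircases r s" "sum g {..<r} < sum (fs ! i) {..<r}"
        "stair_exp r s g \<preceq> stair_exp r s (fs ! i) + unit_exp (2 * j + 1)"
      using staircase_exchange[OF mem] by blast
    obtain l where l: "l < length fs" "g = fs ! l"
      using g(1) fs(1) by (metis in_set_conv_nth)
    then have "l < i"
      using g(2) mono[of i l] by (metis leD leI)
    moreover have "s - (fs ! i) j < s - (fs ! k) j"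
      using j(2) staircase_le[OF mem(2), of j] by linarith
    ultimately show "\<exists>v\<in>{..<2 * r}. Poly_Mapping.lookup (?es ! i) v < Poly_Mapping.lookup (?es ! k) v \<and>
        (\<exists>l<i. ?es ! l \<preceq> ?es ! i + unit_exp v)"
      using j(1) g(3) l ki
      by (intro bexI[of _ "2 * j + 1"]) (auto simp: lookup_stair_exp intro!: exI[of _ l])
  qed
  then show ?thesis by (simp add: fs(1))
qed

section \<open>The Pfaffians\<close>

text \<open>After deletion of row and column \<open>2 * k\<close> of \<open>X3\<close> the remaining indices are matched in
  consecutive pairs, and this is the index of the variable of the \<open>i\<close>-th pair: a pair before the gap
  starts at the even index \<open>2 * i\<close>, and the gap shifts the later ones by one.\<close>

definition pf_var :: "nat \<Rightarrow> nat \<Rightarrow> nat" where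
  "pf_var k i = (if i < k then 2 * i else 2 * i + 1)"

definition unit_step :: "nat \<Rightarrow> nat \<Rightarrow> nat" where
  "unit_step k j = (if j < k then 1 else 0)"

lemma staircases_1: "staircases r 1 = unit_step ` {..r}"
proof
  show "unit_step ` {..r} \<subseteq> staircases r 1"
    by (auto simp: staircases_def antimono_def unit_step_def)
  show "staircases r 1 \<subseteq> unit_step ` {..r}"
  proof
    fix f assume f: "f \<in> staircases r 1"
    define k where "k = (LEAST j. f j = 0)"
    have "f r = 0" using f by (simp add: staircases_def)
    then have "f k = 0" unfolding k_def by (rule LeastI)
    have "k \<le> r" using \<open>f r = 0\<close> unfolding k_def by (rule Least_le)
    have "f j = unit_step k j" for j
    proof (cases "j < k")
      case True
      then have "f j \<noteq> 0" unfolding k_def by (rule not_less_Least)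
      then show ?thesis using True staircase_le[OF f, of j] by (simp add: unit_step_def)
    next
      case False
      then have "f j \<le> f k" using staircase_antimono[OF f] by simp
      then show ?thesis using False \<open>f k = 0\<close> by (simp add: unit_step_def)
    qed
    then show "f \<in> unit_step ` {..r}" using \<open>k \<le> r\<close> by auto
  qed
qed

lemma prod_pf_var:
  "(\<Prod>i<r. pvar (pf_var k i)) = (monom_of (stair_exp r 1 (unit_step k)) :: 'a::comm_ring_1 mpol)"
proof -
  have "(\<Prod>i<n. pvar (pf_var k i)) = (monom_of (\<Sum>i<n. unit_exp (pf_var k i)) :: 'a mpol)" for n
    by (induction n) (simp_all add: pvar_def mult_single)
  moreover have "(\<Sum>i<r. unit_exp (pf_var k i)) = stair_exp r 1 (unit_step k)"
  proof (rule poly_mapping_eqI)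
    fix v :: nat
    have "(\<Sum>i<r. Poly_Mapping.lookup (unit_exp (pf_var k i)) v) =
        (\<Sum>i<r. if i = v div 2 then (if even v \<longleftrightarrow> i < k then 1 else 0) else 0)"
      by (intro sum.cong) (auto simp: lookup_single when_def pf_var_def)
    also have "\<dots> = Poly_Mapping.lookup (stair_exp r 1 (unit_step k)) v"
      by (auto simp: lookup_stair_exp unit_step_def)
    finally show "Poly_Mapping.lookup (\<Sum>i<r. unit_exp (pf_var k i)) v =
        Poly_Mapping.lookup (stair_exp r 1 (unit_step k)) v"
      by (simp add: lookup_sum)
  qed
  ultimately show ?thesis by simp
qed

text \<open>Disjoint pairs of consecutive numbers in increasing order start at least two apart, so
  \<open>i \<le> \<sigma> i\<close> everywhere, which only the identity satisfies.\<close>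

lemma matching_of_consecutive_pairs:
  fixes \<sigma> :: "nat \<Rightarrow> nat"
  assumes perm: "\<sigma> permutes {0..<2 * m}"
    and incr: "\<And>i j. i < j \<Longrightarrow> j < m \<Longrightarrow> \<sigma> (2 * i) < \<sigma> (2 * j)"
    and consec: "\<And>i. i < m \<Longrightarrow> \<sigma> (2 * i + 1) = Suc (\<sigma> (2 * i))"
  shows "\<sigma> = id"
proof -
  have ge: "2 * i \<le> \<sigma> (2 * i)" if "i < m" for i
    using that
  proof (induction i)
    case (Suc i)
    then have "\<sigma> (2 * i) < \<sigma> (2 * Suc i)" using incr[of i "Suc i"] by simp
    moreover have "\<sigma> (2 * Suc i) \<noteq> \<sigma> (2 * i + 1)"
      unfolding inj_eq[OF permutes_inj[OF perm]] by presburger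
    ultimately have "\<sigma> (2 * i) + 2 \<le> \<sigma> (2 * Suc i)" using consec[of i] Suc.prems by simp
    then show ?case using Suc by simp
  qed simp
  have "i \<le> \<sigma> i" if "i < 2 * m" for i
  proof -
    have "i div 2 < m" using that by simp
    then have "2 * (i div 2) \<le> \<sigma> (2 * (i div 2))"
      "\<sigma> (2 * (i div 2) + 1) = Suc (\<sigma> (2 * (i div 2)))"
      using ge consec by blast+
    then show ?thesis
      by (cases "even i") (simp_all add: odd_two_times_div_two_succ)
  qed
  then show ?thesis
    by (intro permutes_natset_ge[OF perm]) auto
qed

lemma X3_delete_entry:
  assumes "l < 2 * r + 1" "p < q" "q < 2 * r"
  shows "mat_delete (X3 (2 * r + 1)) l l $$ (p, q) =
    (if q = Suc p \<and> q \<noteq> l then pvar (if p < l then p else Suc p) else 0 :: 'a::comm_ring_1 mpol)"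
  using assms by (auto simp: mat_delete_def X3_def)

text \<open>A matching with a nonzero product uses consecutive pairs only, so it is the identity
  matching. For odd \<open>l\<close> one of its pairs straddles the deleted index and the entry there vanishes.\<close>

lemma pfaffian_X3_delete:
  assumes l: "l < 2 * r + 1"
  shows "pfaffian (mat_delete (X3 (2 * r + 1)) l l) =
    (if even l then monom_of (stair_exp r 1 (unit_step (l div 2))) else 0 :: 'a::comm_ring_1 mpol)"
proof -
  let ?A = "mat_delete (X3 (2 * r + 1)) l l :: 'a mpol mat"
  define S where "S = {\<sigma>. \<sigma> permutes {0..<2 * r} \<and> (\<forall>i<r. \<sigma> (2 * i) < \<sigma> (2 * i + 1))
    \<and> (\<forall>j<r. \<forall>i<j. \<sigma> (2 * i) < \<sigma> (2 * j))}"
  let ?t = "\<lambda>\<sigma>. of_int (sign \<sigma>) * (\<Prod>i<r. ?A $$ (\<sigma> (2 * i), \<sigma> (2 * i + 1)))"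
  have "dim_row ?A div 2 = r"
    by (simp add: mat_delete_def X3_def)
  then have pf: "pfaffian ?A = (\<Sum>\<sigma>\<in>S. ?t \<sigma>)"
    by (simp add: pfaffian_def S_def Let_def)
  have zero: "?t \<sigma> = 0" if \<sigma>: "\<sigma> \<in> S" "\<sigma> \<noteq> id" for \<sigma>
  proof -
    have perm: "\<sigma> permutes {0..<2 * r}" using \<sigma> by (simp add: S_def)
    obtain i where i: "i < r" "\<sigma> (2 * i + 1) \<noteq> Suc (\<sigma> (2 * i))"
      using matching_of_consecutive_pairs[OF perm] \<sigma> by (auto simp: S_def)
    have "\<sigma> (2 * i + 1) < 2 * r"
      using permutes_in_image[OF perm, of "2 * i + 1"] i(1) by simp
    moreover have "\<sigma> (2 * i) < \<sigma> (2 * i + 1)"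
      using \<sigma>(1) i(1) by (simp add: S_def)
    ultimately have "?A $$ (\<sigma> (2 * i), \<sigma> (2 * i + 1)) = 0"
      using i(2) by (subst X3_delete_entry[OF l]) auto
    then have "(\<Prod>i<r. ?A $$ (\<sigma> (2 * i), \<sigma> (2 * i + 1))) = 0"
      using i(1) by (intro prod_zero) auto
    then show ?thesis by simp
  qed
  have "finite S"
    by (rule finite_subset[OF _ finite_permutations[of "{0..<2 * r}"]]) (auto simp: S_def)
  moreover have "id \<in> S"
    by (auto simp: S_def permutes_id)
  ultimately have "(\<Sum>\<sigma>\<in>S. ?t \<sigma>) = (\<Sum>\<sigma>\<in>{id}. ?t \<sigma>)"
    using zero by (intro sum.mono_neutral_right) auto
  also have "\<dots> = (\<Prod>i<r. ?A $$ (2 * i, 2 * i + 1))"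
    by (simp add: sign_id)
  also have "\<dots> = (\<Prod>i<r. if 2 * i + 1 = l then 0 else pvar (if 2 * i < l then 2 * i else 2 * i + 1))"
    by (intro prod.cong refl, subst X3_delete_entry[OF l]) auto
  also have "\<dots> = (if even l then \<Prod>i<r. pvar (pf_var (l div 2) i) else 0)"
  proof (cases "even l")
    case True
    then have "2 * i + 1 \<noteq> l" "2 * i < l \<longleftrightarrow> i < l div 2" for i by presburger+
    then show ?thesis using True by (simp add: pf_var_def)
  next
    case False
    then obtain k where "l = 2 * k + 1" by (elim oddE)
    with l have "(\<Prod>i<r. if 2 * i + 1 = l then 0 else pvar (if 2 * i < l then 2 * i else 2 * i + 1)) = (0 :: 'a mpol)"
      by (intro prod_zero) (auto intro!: bexI[of _ k])
    then show ?thesis using False by simp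
  qed
  finally show ?thesis by (simp only: pf prod_pf_var)
qed

lemma (in ring) genideal_up_to_zero:
  assumes "M \<subseteq> carrier R" "M \<subseteq> G" "G \<subseteq> insert \<zero> M"
  shows "Idl G = Idl M"
proof
  have G: "G \<subseteq> carrier R" using assms by auto
  interpret M: ideal "Idl M" R by (rule genideal_ideal[OF assms(1)])
  show "Idl G \<subseteq> Idl M"
    using assms(3) genideal_self[OF assms(1)] M.zero_closed
    by (intro genideal_minimal M.is_ideal) auto
  show "Idl M \<subseteq> Idl G"
    using assms(2) genideal_self[OF G] by (intro genideal_minimal genideal_ideal[OF G]) auto
qed

lemma Pf_ideal_eq_monomial_ideal:
  "Pf_ideal (2 * r + 1) =
    (monomial_ideal {..<2 * r} (stair_exp r 1 ` staircases r 1) :: 'a::comm_ring_1 mpol set)"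
proof -
  let ?R = "mpol_ring {..<2 * r} :: 'a mpol ring"
  interpret ring ?R by (rule mpol_ring_ring)
  let ?G = "{pfaffian (mat_delete (X3 (2 * r + 1)) l l) | l. l < 2 * r + 1} :: 'a mpol set"
  let ?M = "monom_of ` stair_exp r 1 ` staircases r 1 :: 'a mpol set"
  have M: "?M = (\<lambda>k. monom_of (stair_exp r 1 (unit_step k))) ` {..r}"
    unfolding staircases_1 by (simp add: image_image)
  have "?G \<subseteq> insert 0 ?M"
  proof
    fix p assume "p \<in> ?G"
    then obtain l where l: "p = pfaffian (mat_delete (X3 (2 * r + 1)) l l)" "l < 2 * r + 1" by blast
    then have "l div 2 \<le> r" by simp
    then show "p \<in> insert 0 ?M"
      unfolding M l(1) pfaffian_X3_delete[OF l(2)] by simp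
  qed
  moreover have "?M \<subseteq> ?G"
  proof -
    have "monom_of (stair_exp r 1 (unit_step k)) \<in> ?G" if "k \<le> r" for k
      using that pfaffian_X3_delete[of "2 * k" r, where 'a = 'a]
      by (intro CollectI exI[of _ "2 * k"]) simp
    then show ?thesis unfolding M by auto
  qed
  moreover have "?M \<subseteq> carrier ?R"
    using keys_stair_exp by auto
  ultimately have "Idl\<^bsub>?R\<^esub> ?G = Idl\<^bsub>?R\<^esub> ?M"
    by (intro genideal_up_to_zero) (simp_all only: mpol_ring_simps)
  also have "\<dots> = monomial_ideal {..<2 * r} (stair_exp r 1 ` staircases r 1)"
    using keys_stair_exp by (intro genideal_eq_monomial_ideal) auto
  finally show ?thesis by (simp add: Pf_ideal_def)
qed

section \<open>Ordinary and symbolic powers\<close>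

lemma Pf_ideal_power:
  "ideal_power (mpol_ring {..<2 * r}) (Pf_ideal (2 * r + 1)) s =
    (monomial_ideal {..<2 * r} (stair_exp r s ` staircases r s) :: 'a::comm_ring_1 mpol set)"
  unfolding Pf_ideal_eq_monomial_ideal
  using keys_stair_exp by (intro monomial_ideal_power stair_exp_0 stair_exp_Suc) auto

text \<open>Let a prime \<open>Q\<close> lie between the Pfaffian ideal and \<open>(a\<^sub>i, b\<^sub>j)\<close>. The \<open>k\<close>-th generator is the
  product of the \<open>a\<^sub>l\<close> with \<open>l < k\<close> and the \<open>b\<^sub>l\<close> with \<open>l \<ge> k\<close>, and one of its factors lies in \<open>Q\<close>, hence
  is \<open>a\<^sub>i\<close> or \<open>b\<^sub>j\<close>. Taking \<open>k = j + 1\<close> excludes \<open>b\<^sub>j\<close> and taking \<open>k = i\<close> excludes \<open>a\<^sub>i\<close>, so \<open>Q\<close> contains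
  both. That these are some of the minimal primes is enough to bound the symbolic power.\<close>

lemma minimal_prime_of_Pf_ideal:
  assumes ij: "i \<le> j" "j < r"
  shows "monomial_ideal {..<2 * r} (unit_exp ` {2 * i, 2 * j + 1}) \<in>
    minimal_primes (mpol_ring {..<2 * r}) (Pf_ideal (2 * r + 1) :: 'a::idom mpol set)"
proof -
  let ?V = "{..<2 * r}" and ?W = "{2 * i, 2 * j + 1}"
  let ?R = "mpol_ring ?V :: 'a mpol ring"
  let ?P = "monomial_ideal ?V (unit_exp ` ?W) :: 'a mpol set"
  let ?I = "Pf_ideal (2 * r + 1) :: 'a mpol set"
  interpret ring ?R by (rule mpol_ring_ring)
  have genP: "?P = Idl\<^bsub>?R\<^esub> (monom_of ` unit_exp ` ?W)"
    using ij by (intro genideal_eq_monomial_ideal[symmetric]) auto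
  have genI: "?I = Idl\<^bsub>?R\<^esub> (monom_of ` stair_exp r 1 ` staircases r 1)"
    unfolding Pf_ideal_eq_monomial_ideal
    using keys_stair_exp by (intro genideal_eq_monomial_ideal[symmetric]) auto
  have "?I \<subseteq> ?P"
    unfolding genI
  proof (rule genideal_minimal[OF monomial_ideal_is_ideal], safe)
    fix f assume f: "f \<in> staircases r 1"
    have "f j \<le> f i" using staircase_antimono[OF f] ij by simp
    then have "2 * i \<in> Poly_Mapping.keys (stair_exp r 1 f) \<or> 2 * j + 1 \<in> Poly_Mapping.keys (stair_exp r 1 f)"
      using ij by (auto simp: in_keys_iff lookup_stair_exp)
    then show "monom_of (stair_exp r 1 f) \<in> ?P"
      using keys_stair_exp[of r 1 f]
      by (auto simp: monom_of_in_monomial_ideal unit_exp_divides_iff simp del: One_nat_def)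
  qed
  moreover have "?P \<subseteq> Q" if Q: "primeideal Q ?R" "?I \<subseteq> Q" "Q \<subseteq> ?P" for Q
  proof -
    have var: "\<exists>l<r. pf_var k l \<in> ?W \<and> pvar (pf_var k l) \<in> Q" if "k \<le> r" for k
    proof -
      have "unit_step k \<in> staircases r 1" using that unfolding staircases_1 by simp
      then have "monom_of (stair_exp r 1 (unit_step k)) \<in> ?I"
        unfolding Pf_ideal_eq_monomial_ideal using keys_stair_exp
        by (intro generator_in_monomial_ideal) auto
      then have "(\<Prod>l<r. pvar (pf_var k l)) \<in> Q"
        using Q(2) by (auto simp: prod_pf_var)
      moreover have "pvar (pf_var k l) \<in> carrier ?R" if "l \<in> {..<r}" for l
        using that by (auto simp: pvar_def pf_var_def)
      ultimately obtain l where l: "l < r" "pvar (pf_var k l) \<in> Q"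
        using primeideal_prod_mem[OF Q(1), of "{..<r}" "\<lambda>l. pvar (pf_var k l)"] by blast
      then have "monom_of (unit_exp (pf_var k l)) \<in> ?P"
        using Q(3) by (auto simp: pvar_def)
      then have "pf_var k l \<in> ?W"
        by (auto simp: monom_of_in_monomial_ideal unit_exp_divides_iff simp del: One_nat_def)
      then show ?thesis using l by blast
    qed
    have "pvar (2 * i) \<in> Q"
    proof -
      obtain l where "pf_var (Suc j) l \<in> ?W" "pvar (pf_var (Suc j) l) \<in> Q"
        using var[of "Suc j"] ij by auto
      moreover from this have "pf_var (Suc j) l = 2 * i"
        by (auto simp: pf_var_def split: if_splits; presburger)
      ultimately show ?thesis by simp
    qed
    moreover have "pvar (2 * j + 1) \<in> Q"
    proof -
      obtain l where "pf_var i l \<in> ?W" "pvar (pf_var i l) \<in> Q"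
        using var[of i] ij by auto
      moreover from this have "pf_var i l = 2 * j + 1"
        by (auto simp: pf_var_def split: if_splits; presburger)
      ultimately show ?thesis by simp
    qed
    ultimately show "?P \<subseteq> Q"
      unfolding genP using primeideal.axioms(1)[OF Q(1)]
      by (intro genideal_minimal) (auto simp: pvar_def)
  qed
  ultimately show ?thesis
    using primeideal_variables[of ?V ?W, where 'a = 'a]
    unfolding minimal_primes_def by blast
qed

lemma symbolic_power_subset:
  "P \<in> minimal_primes R I \<Longrightarrow> symbolic_power R I s \<subseteq> ideal_power R P s"
  by (auto simp: symbolic_power_def)

text \<open>A monomial in the symbolic power has degree at least \<open>s\<close> in each pair \<open>a\<^sub>i, b\<^sub>j\<close> with
  \<open>i \<le> j\<close>, and \<open>stair_exp_below\<close> then finds a generator of the ordinary power dividing it.\<close>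

lemma Pf_ideal_symbolic_power:
  "symbolic_power (mpol_ring {..<2 * r}) (Pf_ideal (2 * r + 1)) s =
    ideal_power (mpol_ring {..<2 * r}) (Pf_ideal (2 * r + 1) :: 'a::idom mpol set) s"
    (is "symbolic_power ?R ?I s = _")
proof
  have "ideal (ideal_power ?R ?I s) ?R"
    unfolding Pf_ideal_power by (rule monomial_ideal_is_ideal)
  then have "ideal_power ?R ?I s \<subseteq> carrier ?R"
    by (intro additive_subgroup.a_subset ideal.axioms(1))
  then show "ideal_power ?R ?I s \<subseteq> symbolic_power ?R ?I s"
    using ideal_power_mono[of ?I _ ?R s]
    by (auto simp: symbolic_power_def minimal_primes_def)
  show "symbolic_power ?R ?I s \<subseteq> ideal_power ?R ?I s"
  proof
    fix p assume p: "p \<in> symbolic_power ?R ?I s"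
    have "\<exists>u\<in>stair_exp r s ` staircases r s. u \<preceq> m" if m: "m \<in> Poly_Mapping.keys p" for m
    proof -
      have "s \<le> Poly_Mapping.lookup m (2 * i) + Poly_Mapping.lookup m (2 * j + 1)"
        if "i \<le> j" "j < r" for i j
      proof -
        let ?W = "{2 * i, 2 * j + 1}"
        have "p \<in> ideal_power ?R (monomial_ideal {..<2 * r} (unit_exp ` ?W)) s"
          using p symbolic_power_subset[OF minimal_prime_of_Pf_ideal[OF that]] by (rule subsetD[rotated])
        then have "s \<le> (\<Sum>v\<in>?W. Poly_Mapping.lookup m v)"
          by (rule lookup_prime_power[OF _ _ m, rotated]) simp
        moreover have "2 * i \<noteq> 2 * j + 1" by presburger
        ultimately show ?thesis by simp
      qed
      then show ?thesis using stair_exp_below[of r s m] by blast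
    qed
    then show "p \<in> ideal_power ?R ?I s"
      using p unfolding Pf_ideal_power by (simp add: monomial_ideal_def symbolic_power_def)
  qed
qed

theorem corollary3p6:
  fixes r n s :: nat and I :: "'a::field_char_0 mpol set"
  assumes "n = 2 * r + 1"
    and "I = Pf_ideal n"
    and "s \<ge> 1"
  shows "has_linear_quotients {..<n - 1} (ideal_power (mpol_ring {..<n - 1}) I s) \<and>
         has_linear_quotients {..<n - 1} (symbolic_power (mpol_ring {..<n - 1}) I s)"
proof -
  have "has_linear_quotients {..<2 * r} (ideal_power (mpol_ring {..<2 * r}) (Pf_ideal (2 * r + 1) :: 'a mpol set) s)"
    unfolding Pf_ideal_power by (rule has_linear_quotients_staircases)
  moreover have "n - 1 = 2 * r" "I = Pf_ideal (2 * r + 1)"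
    using assms(1,2) by simp_all
  ultimately show ?thesis by (simp only: Pf_ideal_symbolic_power)
qed

end
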